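(* Let $f:\mathbb{N}\to[0,\infty)$ be non-increasing with $\sum_{n=1}^\infty f(n)=\infty$, and let $\mathcal{I}_f=\{A\subseteq\mathbb{N}\mid \sum_{n\in A}f(n)<\infty\}$. Then there exists an $\mathcal{I}_f$-TAD family $\mathcal{A}$ of the cardinality of the continuum. In consequence, there exists an abstract upper density $\delta$ that is translation invariant and rich, and such that $\mathcal{Z}_\delta=\mathcal{I}_f$.
   Context: $\mathbb{N}$ is the set of positive integers. For $A\subseteq\mathbb{N}$ and $k\in\mathbb{Z}$, $A+k:=\{a+k\mid a\in A,\ a+k\in\mathbb{N}\}$. For an ideal $\mathcal{I}$ (a nonempty family of subsets of $\mathbb{N}$, not containing $\mathbb{N}$, closed under subsets and finite unions), two sets $A,B\subseteq\mathbb{N}$ are $\mathcal{I}$-TAD if $(A+s)\cap(B+t)\in\mathcal{I}$ for all $s,t\in\mathbb{Z}$; a family $\mathcal{A}$ is $\mathcal{I}$-TAD if $\mathcal{A}\cap\mathcal{I}=\emptyset$, its members are infinite, and any two distinct members are $\mathcal{I}$-TAD. An abstract upper density is a function $\delta:\mathcal{P}(\mathbb{N})\to[0,1]$ with $\delta(\mathbb{N})=1$, $\delta(F)=0$ for all finite $F$, $\delta(A)\le\delta(B)$ whenever $A\subseteq B$, and $\delta(A\cup B)\le\delta(A)+\delta(B)$. It is translation invariant if $\delta(A+m)=\delta(A-m)=\delta(A)$ for all $A\subseteq\mathbb{N}$, $m\in\mathbb{N}$ (where $A-m=\{k\in\mathbb{N}\mid k+m\in A\}$), and rich if every $r\in[0,1]$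 equals $\delta(A)$ for some $A\subseteq\mathbb{N}$. $\mathcal{Z}_\delta:=\{A\subseteq\mathbb{N}\mid\delta(A)=0\}$. *)

theory Defs
  imports "HOL-Analysis.Analysis" "HOL-Library.Equipollence"
begin

text \<open>The natural numbers start at 1 here; their set is rendered as the subset
  \<^term>\<open>{1::nat..}\<close> of the type \<^typ>\<open>nat\<close>, to which every notion below is relativised.\<close>

abbreviation PN :: "nat set" where
  "PN \<equiv> {1..}"

definition translate :: "nat set \<Rightarrow> int \<Rightarrow> nat set" where
  "translate A k = {n \<in> PN. \<exists>a\<in>A. int n = int a + k}"

definition ideal_on_PN :: "nat set set \<Rightarrow> bool" where
  "ideal_on_PN I \<longleftrightarrow>
     I \<subseteq> Pow PN \<and> I \<noteq> {} \<and> PN \<notin> I \<and>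
     (\<forall>A\<in>I. \<forall>B. B \<subseteq> A \<longrightarrow> B \<in> I) \<and>
     (\<forall>A\<in>I. \<forall>B\<in>I. A \<union> B \<in> I)"

definition TAD :: "nat set set \<Rightarrow> nat set \<Rightarrow> nat set \<Rightarrow> bool" where
  "TAD I A B \<longleftrightarrow> (\<forall>s t :: int. translate A s \<inter> translate B t \<in> I)"

definition TAD_family :: "nat set set \<Rightarrow> nat set set \<Rightarrow> bool" where
  "TAD_family I \<A> \<longleftrightarrow>
     \<A> \<subseteq> Pow PN \<and> \<A> \<inter> I = {} \<and> (\<forall>A\<in>\<A>. infinite A) \<and>
     (\<forall>A\<in>\<A>. \<forall>B\<in>\<A>. A \<noteq> B \<longrightarrow> TAD I A B)"

definition abstract_upper_density :: "(nat set \<Rightarrow> real) \<Rightarrow> bool" where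
  "abstract_upper_density \<delta> \<longleftrightarrow>
     (\<forall>A. A \<subseteq> PN \<longrightarrow> \<delta> A \<in> {0..1}) \<and>
     \<delta> PN = 1 \<and>
     (\<forall>F. F \<subseteq> PN \<longrightarrow> finite F \<longrightarrow> \<delta> F = 0) \<and>
     (\<forall>A B. A \<subseteq> B \<longrightarrow> B \<subseteq> PN \<longrightarrow> \<delta> A \<le> \<delta> B) \<and>
     (\<forall>A B. A \<subseteq> PN \<longrightarrow> B \<subseteq> PN \<longrightarrow> \<delta> (A \<union> B) \<le> \<delta> A + \<delta> B)"

definition translation_invariant :: "(nat set \<Rightarrow> real) \<Rightarrow> bool" where
  "translation_invariant \<delta> \<longleftrightarrow>
     (\<forall>A m. A \<subseteq> PN \<longrightarrow> m \<in> PN \<longrightarrow>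
        \<delta> (translate A (int m)) = \<delta> A \<and> \<delta> {k \<in> PN. k + m \<in> A} = \<delta> A)"

definition rich :: "(nat set \<Rightarrow> real) \<Rightarrow> bool" where
  "rich \<delta> \<longleftrightarrow> (\<forall>r\<in>{0..1}. \<exists>A. A \<subseteq> PN \<and> \<delta> A = r)"

definition zero_ideal :: "(nat set \<Rightarrow> real) \<Rightarrow> nat set set" where
  "zero_ideal \<delta> = {A. A \<subseteq> PN \<and> \<delta> A = 0}"

text \<open>Only used for functions that are nonnegative on \<^term>\<open>PN\<close>, where
  unconditional summability over a set says that the sum over that set is finite.\<close>

definition summable_ideal :: "(nat \<Rightarrow> real) \<Rightarrow> nat set set" where
  "summable_ideal f = {A. A \<subseteq> PN \<and> f summable_on A}"

lemma ideal_summable_ideal: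
  assumes "\<not> f summable_on PN"
  shows "ideal_on_PN (summable_ideal f)"
proof -
  have "f summable_on B" if "f summable_on A" "B \<subseteq> A" for A B
    using that by (rule summable_on_subset_banach)
  moreover have "f summable_on (A \<union> B)" if "f summable_on A" "f summable_on B" for A B
    using that by (rule summable_on_union)
  moreover have "{} \<in> summable_ideal f"
    by (simp add: summable_ideal_def)
  ultimately show ?thesis
    using assms unfolding ideal_on_PN_def summable_ideal_def by blast
qed

lemma translate_uminus: "translate A (- int m) = {k \<in> PN. k + m \<in> A}"
proof -
  have "int n = int a + - int m \<longleftrightarrow> a = n + m" for n a by auto
  then show ?thesis unfolding translate_def by (simp only: bex_simps) auto
qed

end

theory Submission
  imports Defs
begin

text \<open>
  Choose consecutive finite blocks, the \<open>m\<close>-th one an arithmetic progression of step \<open>m + 1\<close> whose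
  \<open>f\<close>-mass is at least 1; monotonicity of \<open>f\<close> makes the mass along every progression infinite.
  Since the gaps in the union of the blocks tend to infinity, translates of two unions of blocks
  meet in a finite set as soon as the two index sets do. Continuum many pairwise almost disjoint
  infinite index sets then give the family.

  For the density, write the family as \<open>A q\<close> with \<open>q\<close> real and let \<open>I\<^sub>r\<close> be the ideal
  generated by \<open>I\<close> and the translates of the \<open>A q\<close> with \<open>0 < q \<le> r\<close>. The value at \<open>X\<close> is the
  infimum of all \<open>r < 1\<close> with \<open>X \<in> I\<^sub>r\<close>, or 1 if there is none. It is a maximum-like function of \<open>X\<close>,
  and \<open>A r\<close> has value \<open>r\<close>. It vanishes only on \<open>I\<close>: a set covered by translates of finitely many
  \<open>A q\<close>, and also by translates of other \<open>A q\<close> with smaller indices, lies in \<open>I\<close>.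
\<close>

section \<open>Almost disjoint families of unions of blocks\<close>

text \<open>The path of \<open>S\<close> in the binary tree: its nodes are the finite initial
  segments of \<open>S\<close>, coded as natural numbers. These paths form the classical almost
  disjoint family of size continuum.\<close>

definition branch :: "nat set \<Rightarrow> nat set" where
  "branch S = range (\<lambda>n. prod_encode (n, set_encode (S \<inter> {..<n})))"

lemma infinite_branch: "infinite (branch S)"
  unfolding branch_def by (intro range_inj_infinite injI) (simp add: prod_encode_eq)

text \<open>Once \<open>n\<close> exceeds a point \<open>k\<close> that separates \<open>S\<close>
  from \<open>T\<close>, the initial segments differ, so common nodes have length at most
  \<open>k\<close>.\<close>

lemma finite_branch_Int:
  assumes "S \<noteq> T"
  shows "finite (branch S \<inter> branch T)"
proof -
  obtain k where k: "\<not> (k \<in> S \<longleftrightarrow> k \<in> T)" using assms by blast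
  have "branch S \<inter> branch T \<subseteq> (\<lambda>n. prod_encode (n, set_encode (S \<inter> {..<n}))) ` {..k}"
  proof
    fix x assume "x \<in> branch S \<inter> branch T"
    then obtain n m where x: "x = prod_encode (n, set_encode (S \<inter> {..<n}))"
      and "x = prod_encode (m, set_encode (T \<inter> {..<m}))"
      unfolding branch_def by blast
    then have "S \<inter> {..<n} = T \<inter> {..<n}"
      by (auto simp: prod_encode_eq set_encode_eq)
    then have "\<not> k < n" using k by blast
    then show "x \<in> (\<lambda>n. prod_encode (n, set_encode (S \<inter> {..<n}))) ` {..k}"
      using x by auto
  qed
  then show ?thesis by (rule finite_subset) simp
qed

section \<open>Finite blocks with gaps tending to infinity\<close>

definition sparse_blocks :: "(nat \<Rightarrow> nat set) \<Rightarrow> bool" where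
  "sparse_blocks F \<longleftrightarrow>
     (\<forall>i. finite (F i) \<and> F i \<subseteq> PN) \<and>
     (\<forall>i j x y. i < j \<longrightarrow> x \<in> F i \<longrightarrow> y \<in> F j \<longrightarrow> x < y) \<and>
     (\<forall>i j x y. x \<in> F i \<longrightarrow> y \<in> F j \<longrightarrow> x < y \<longrightarrow> i < y - x)"

text \<open>A common point comes from \<open>a\<close> and \<open>b\<close> at distance
  \<open>\<bar>s - t\<bar>\<close>. If they are equal, their block has its index in
  \<open>X \<inter> Y\<close>; otherwise the gap condition bounds the block index of the smaller one
  by that distance. Both cases leave finitely many candidates.\<close>

lemma finite_translate_Int_blocks:
  assumes F: "sparse_blocks F" and fin: "finite (X \<inter> Y)"
  shows "finite (translate (\<Union>(F ` X)) s \<inter> translate (\<Union>(F ` Y)) t)"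
proof -
  define D where "D = nat \<bar>s - t\<bar>"
  define G where "G = \<Union>(F ` ((X \<inter> Y) \<union> {..<D}))"
  have "finite G" using F fin by (auto simp: G_def sparse_blocks_def)
  have "translate (\<Union>(F ` X)) s \<inter> translate (\<Union>(F ` Y)) t
      \<subseteq> (\<lambda>a. nat (int a + s)) ` G \<union> (\<lambda>b. nat (int b + t)) ` G"
  proof
    fix n assume "n \<in> translate (\<Union>(F ` X)) s \<inter> translate (\<Union>(F ` Y)) t"
    then obtain a b i j where ab: "i \<in> X" "a \<in> F i" "int n = int a + s"
      "j \<in> Y" "b \<in> F j" "int n = int b + t"
      unfolding translate_def by blast
    have n: "n = nat (int a + s)" "n = nat (int b + t)" using ab by linarith+
    consider "a = b" | "a < b" | "b < a" by linarith
    then have "a \<in> G \<or> b \<in> G"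
    proof cases
      case 1
      then have "i = j" using F ab unfolding sparse_blocks_def
        by (metis less_irrefl linorder_neqE_nat)
      then show ?thesis using ab by (auto simp: G_def)
    next
      case 2
      then have "i < b - a" using F ab unfolding sparse_blocks_def by blast
      also have "b - a = D" using ab 2 by (auto simp: D_def)
      finally show ?thesis using ab by (auto simp: G_def)
    next
      case 3
      then have "j < a - b" using F ab unfolding sparse_blocks_def by blast
      also have "a - b = D" using ab 3 by (auto simp: D_def)
      finally show ?thesis using ab by (auto simp: G_def)
    qed
    then show "n \<in> (\<lambda>a. nat (int a + s)) ` G \<union> (\<lambda>b. nat (int b + t)) ` G"
      using n by blast
  qed
  then show ?thesis by (rule finite_subset) (use \<open>finite G\<close> in simp)
qed

text \<open>The blocks are disjoint, so any \<open>k\<close> of them carry mass at least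
  \<open>k\<close>, which exceeds every candidate for a finite total.\<close>

lemma not_summable_on_Union_blocks:
  fixes f :: "nat \<Rightarrow> real"
  assumes f: "\<And>n. n \<in> PN \<Longrightarrow> 0 \<le> f n" and F: "sparse_blocks F"
    and mass: "\<And>i. 1 \<le> sum f (F i)" and X: "infinite X"
  shows "\<not> f summable_on \<Union>(F ` X)"
proof
  assume summ: "f summable_on \<Union>(F ` X)"
  define C where "C = infsum f (\<Union>(F ` X))"
  obtain k :: nat where k: "C < real k" using reals_Archimedean2 by blast
  obtain Y where Y: "Y \<subseteq> X" "finite Y" "card Y = k"
    using X infinite_arbitrarily_large by metis
  have disj: "F i \<inter> F j = {}" if "i \<noteq> j" for i j
    using F that unfolding sparse_blocks_def by (metis disjoint_iff less_irrefl linorder_neqE_nat)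
  have "real k = (\<Sum>i\<in>Y. 1)" using Y by simp
  also have "\<dots> \<le> (\<Sum>i\<in>Y. sum f (F i))" using mass by (intro sum_mono)
  also have "\<dots> = sum f (\<Union>(F ` Y))"
    using F Y disj by (intro sum.UNION_disjoint [symmetric]) (auto simp: sparse_blocks_def)
  also have "\<dots> \<le> C"
    unfolding C_def using summ
  proof (rule finite_sum_le_infsum)
    show "finite (\<Union>(F ` Y))" using F Y by (auto simp: sparse_blocks_def)
    show "\<Union>(F ` Y) \<subseteq> \<Union>(F ` X)" using Y by blast
    show "0 \<le> f x" if "x \<in> \<Union>(F ` X) - \<Union>(F ` Y)" for x
      using that F f unfolding sparse_blocks_def by blast
  qed
  finally show False using k by simp
qed

section \<open>Monotone weights\<close>

lemma finite_in_summable_ideal: "finite X \<Longrightarrow> X \<subseteq> PN \<Longrightarrow> X \<in> summable_ideal f"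
  by (simp add: summable_ideal_def)

context
  fixes f :: "nat \<Rightarrow> real"
  assumes f_nonneg: "\<And>n. n \<in> PN \<Longrightarrow> 0 \<le> f n"
    and f_mono: "\<And>m n. 1 \<le> m \<Longrightarrow> m \<le> n \<Longrightarrow> f n \<le> f m"
begin

text \<open>By monotonicity each term of the progression dominates the \<open>d\<close> terms from
  it up to the next one. Used in contrapositive form: divergence on \<open>PN\<close> forces
  divergence along every progression.\<close>

lemma summable_on_PN_of_progression:
  assumes "1 \<le> a" "1 \<le> d" and bound: "\<And>N. (\<Sum>j<N. f (a + j * d)) \<le> C"
  shows "f summable_on PN"
proof -
  have pos: "0 \<le> f (a + k)" for k using f_nonneg assms(1) by simp
  have "(\<Sum>k<M. f (a + k)) \<le> real d * C" for M
  proof -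
    \<comment> \<open>Enlarging the range from \<open>M\<close> to \<open>M * d\<close> terms lets
      it split into \<open>M\<close> runs of length \<open>d\<close>.\<close>
    have "(\<Sum>k<M. f (a + k)) \<le> (\<Sum>k<M * d. f (a + k))"
      using pos assms(2) by (intro sum_mono2) auto
    also have "\<dots> = (\<Sum>j<M. \<Sum>k = j * d..<j * d + d. f (a + k))"
      by (rule sum.nat_group [symmetric])
    also have "\<dots> \<le> (\<Sum>j<M. \<Sum>k = j * d..<j * d + d. f (a + j * d))"
      using assms(1) by (intro sum_mono f_mono) auto
    also have "\<dots> = real d * (\<Sum>j<M. f (a + j * d))"
      by (simp add: sum_distrib_left)
    also have "\<dots> \<le> real d * C" using bound by (intro mult_left_mono) auto
    finally show ?thesis .
  qed
  then have "summable (\<lambda>k. f (a + k))" using pos by (rule summableI_nonneg_bounded [rotated])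
  \<comment> \<open>The shift adds only the finitely many terms before \<open>a\<close>. Norms are
    taken because the sign of \<open>f 0\<close> is unknown.\<close>
  then have "summable (\<lambda>k. norm (f (k + a)))" using pos by (simp add: add.commute)
  then have "summable (\<lambda>n. norm (f n))"
    by (subst (asm) summable_iff_shift [where f = "\<lambda>n. norm (f n)"])
  then show ?thesis
    using norm_summable_imp_summable_on summable_on_subset_banach subset_UNIV by blast
qed

lemma ex_sparse_blocks:
  assumes div: "\<not> f summable_on PN"
  shows "\<exists>F. sparse_blocks F \<and> (\<forall>i. 1 \<le> sum f (F i))"
proof -
  have "\<exists>N. 1 \<le> (\<Sum>j<N. f (a + j * d))" if "1 \<le> a" "1 \<le> d" for a d
    using summable_on_PN_of_progression [OF that, of 1] div by (meson linear)
  then obtain len where len: "\<And>a d. 1 \<le> a \<Longrightarrow> 1 \<le> d \<Longrightarrow> 1 \<le> (\<Sum>j<len a d. f (a + j * d))"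
    by metis
  \<comment> \<open>Block \<open>m\<close> has step \<open>Suc m\<close>, and the next block starts
    one full step after its last term, so the gap between the two blocks also exceeds
    \<open>m\<close>.\<close>
  define start where "start = rec_nat 1 (\<lambda>m a. a + len a (Suc m) * Suc m)"
  define F where "F m = (\<lambda>j. start m + j * Suc m) ` {..<len (start m) (Suc m)}" for m
  have start_Suc: "start (Suc m) = start m + len (start m) (Suc m) * Suc m" for m
    by (simp add: start_def)
  have start_mono: "start i \<le> start j" if "i \<le> j" for i j
    using that by (rule lift_Suc_mono_le [rotated]) (simp add: start_Suc)
  have start_pos: "1 \<le> start m" for m
    using start_mono [of 0 m] by (simp add: start_def)
  have lower: "start m \<le> x" if "x \<in> F m" for m x
    using that by (auto simp: F_def)
  have upper: "x + m < start (Suc m)" if "x \<in> F m" for m x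
  proof -
    from that obtain j where j: "j < len (start m) (Suc m)" "x = start m + j * Suc m"
      by (auto simp: F_def)
    then have "Suc j * Suc m \<le> len (start m) (Suc m) * Suc m"
      by (intro mult_le_mono1) simp
    then show ?thesis using j(2) unfolding start_Suc by simp
  qed
  have later: "x + i < y" if "i < j" "x \<in> F i" "y \<in> F j" for i j x y
    using upper [OF that(2)] start_mono [of "Suc i" j] lower [OF that(3)] that(1) by simp
  have gap: "i < y - x" if xy: "x \<in> F i" "y \<in> F j" "x < y" for i j x y
  proof -
    consider "i < j" | "i = j" | "j < i" by linarith
    then show ?thesis
    proof cases
      case 1
      then show ?thesis using later xy by fastforce
    next
      case 2
      then obtain k l where kl: "x = start i + k * Suc i" "y = start i + l * Suc i"
        using xy by (auto simp: F_def)
      then have "k * Suc i < l * Suc i" using xy(3) by linarith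
      then have "k < l" by (rule mult_less_cancel2 [THEN iffD1, THEN conjunct2])
      then have "Suc k * Suc i \<le> l * Suc i" by (intro mult_le_mono1) simp
      then show ?thesis using kl by simp
    next
      case 3
      then show ?thesis using later [OF 3 xy(2,1)] xy(3) by simp
    qed
  qed
  have "F m \<subseteq> PN" for m
    using lower [of _ m] start_pos [of m] by (meson atLeast_iff order_trans subsetI)
  moreover have "finite (F m)" for m by (simp add: F_def)
  moreover have "x < y" if "i < j" "x \<in> F i" "y \<in> F j" for i j x y
    using later [OF that] by simp
  ultimately have "sparse_blocks F" unfolding sparse_blocks_def using gap by blast
  moreover have "1 \<le> sum f (F m)" for m
  proof -
    have "inj_on (\<lambda>j. start m + j * Suc m) {..<len (start m) (Suc m)}"
      by (intro inj_onI) (simp del: mult_Suc_right)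
    then have "sum f (F m) = (\<Sum>j<len (start m) (Suc m). f (start m + j * Suc m))"
      by (simp add: F_def sum.reindex del: mult_Suc_right)
    then show ?thesis using len [OF start_pos [of m], of "Suc m"] by simp
  qed
  ultimately show ?thesis by blast
qed

lemma ex_TAD_family_summable_ideal:
  assumes "\<not> f summable_on PN"
  shows "\<exists>\<A>. TAD_family (summable_ideal f) \<A> \<and> \<A> \<approx> (UNIV :: real set)"
proof -
  obtain F where F: "sparse_blocks F" and mass: "\<And>i. 1 \<le> sum f (F i)"
    using ex_sparse_blocks [OF assms] by blast
  define A where "A S = \<Union>(F ` branch S)" for S
  have sub: "A S \<subseteq> PN" for S using F by (auto simp: A_def sparse_blocks_def)
  have large: "A S \<notin> summable_ideal f" for S
    using not_summable_on_Union_blocks [OF f_nonneg F mass infinite_branch]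
    by (simp add: A_def summable_ideal_def)
  have inf: "infinite (A S)" for S
    using large finite_in_summable_ideal sub by blast
  have TAD: "TAD (summable_ideal f) (A S) (A T)" if "S \<noteq> T" for S T
    unfolding TAD_def
  proof (intro allI finite_in_summable_ideal)
    show "finite (translate (A S) s \<inter> translate (A T) t)" for s t
      unfolding A_def by (rule finite_translate_Int_blocks [OF F finite_branch_Int [OF that]])
    show "translate (A S) s \<inter> translate (A T) t \<subseteq> PN" for s t
      by (auto simp: translate_def)
  qed
  have "inj A"
  proof (rule injI, rule ccontr)
    fix S T assume "A S = A T" "S \<noteq> T"
    \<comment> \<open>Equal members with different indices would be almost disjoint from themselves;
      the shifts \<open>s = t = 0\<close> then put \<open>A S\<close> into the ideal.\<close>
    then have "translate (A S) 0 \<inter> translate (A S) 0 \<in> summable_ideal f"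
      using TAD [of S T] unfolding TAD_def by metis
    moreover have "translate (A S) 0 = A S" using sub [of S] by (auto simp: translate_def)
    ultimately show False using large by simp
  qed
  then have "range A \<approx> (UNIV :: nat set set)" by (rule inj_on_image_eqpoll_self)
  then have "range A \<approx> (UNIV :: real set)" using nat_sets_eqpoll_reals by (rule eqpoll_trans)
  moreover have "TAD_family (summable_ideal f) (range A)"
    unfolding TAD_family_def using sub large inf by (auto intro: TAD)
  ultimately show ?thesis by blast
qed

text \<open>A shift to the left can increase the sum of \<open>f\<close> only by a telescoping sum.\<close>

lemma summable_on_difference: "(\<lambda>n. f n - f (n + m)) summable_on PN"
proof (induction m)
  case (Suc m)
  have "(\<Sum>n<N. f (Suc n + m) - f (Suc (Suc n + m))) \<le> f (Suc m)" for N
  proof -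
    have "(\<Sum>n<N. f (Suc n + m) - f (Suc (Suc n + m))) = f (Suc m) - f (Suc (N + m))"
      using sum_lessThan_telescope' [of "\<lambda>n. f (Suc n + m)" N] by simp
    then show ?thesis using f_nonneg by simp
  qed
  moreover have pos: "0 \<le> f (Suc n + m) - f (Suc (Suc n + m))" for n
    using f_mono [of "Suc n + m" "Suc (Suc n + m)"] by simp
  ultimately have "summable (\<lambda>n. f (Suc n + m) - f (Suc (Suc n + m)))"
    by (intro summableI_nonneg_bounded)
  then have "(\<lambda>n. f (Suc n + m) - f (Suc (Suc n + m))) summable_on UNIV"
    using pos by (intro norm_summable_imp_summable_on) (simp only: real_norm_def abs_of_nonneg)
  then have "((\<lambda>n. f (n + m) - f (Suc (n + m))) \<circ> Suc) summable_on UNIV"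
    by (simp add: o_def)
  then have "(\<lambda>n. f (n + m) - f (Suc (n + m))) summable_on range Suc"
    by (subst summable_on_reindex) auto
  moreover have "range Suc = PN"
    by (auto simp: image_iff Suc_le_eq gr0_conv_Suc)
  ultimately have "(\<lambda>n. f (n + m) - f (Suc (n + m))) summable_on PN" by simp
  from summable_on_add [OF Suc.IH this] show ?case by simp
qed simp

text \<open>A right shift only decreases the weights. For a left shift by \<open>Suc m\<close>,
  write \<open>f n\<close> as \<open>f (n + Suc m)\<close> plus a difference: the first part is a
  sum over a subset of \<open>X\<close>, the second telescopes.\<close>

lemma translate_in_summable_ideal:
  assumes X: "X \<in> summable_ideal f"
  shows "translate X k \<in> summable_ideal f"
proof -
  have sub: "X \<subseteq> PN" and summ: "f summable_on X" using X by (auto simp: summable_ideal_def)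
  have "f summable_on translate X k"
  proof (cases k)
    case (nonneg m)
    have "(\<lambda>n. f (n + m)) summable_on X"
    proof (rule summable_on_comparison_test [OF summ])
      fix n assume "n \<in> X"
      then have "1 \<le> n" using sub by auto
      then show "f (n + m) \<le> f n" "0 \<le> f (n + m)"
        using f_mono [of n "n + m"] f_nonneg [of "n + m"] by auto
    qed
    then have "(f \<circ> (\<lambda>n. n + m)) summable_on X" by (simp add: o_def)
    then have "f summable_on (\<lambda>n. n + m) ` X" by (subst summable_on_reindex) auto
    moreover have "translate X k = (\<lambda>n. n + m) ` X"
    proof -
      have "int n = int a + int m \<longleftrightarrow> n = a + m" for n a by linarith
      then show ?thesis using sub nonneg by (auto simp: translate_def)
    qed
    ultimately show ?thesis by simp
  next
    case (neg m)
    define Y where "Y = {n \<in> PN. n + Suc m \<in> X}"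
    have Y: "translate X k = Y" unfolding neg Y_def by (rule translate_uminus)
    have "f summable_on (\<lambda>n. n + Suc m) ` Y"
      using summ by (rule summable_on_subset_banach) (auto simp: Y_def)
    then have "(\<lambda>n. f (n + Suc m)) summable_on Y"
      by (subst (asm) summable_on_reindex) (auto simp: o_def inj_on_def)
    moreover have "(\<lambda>n. f n - f (n + Suc m)) summable_on Y"
      using summable_on_difference by (rule summable_on_subset_banach) (auto simp: Y_def)
    ultimately have "(\<lambda>n. f (n + Suc m) + (f n - f (n + Suc m))) summable_on Y"
      by (rule summable_on_add)
    then show ?thesis by (simp add: Y)
  qed
  then show ?thesis by (auto simp: summable_ideal_def translate_def)
qed

end

section \<open>The density of a translation almost disjoint family\<close>

lemma translate_subset_PN: "translate A k \<subseteq> PN"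
  by (auto simp: translate_def)

lemma translate_mono: "A \<subseteq> B \<Longrightarrow> translate A k \<subseteq> translate B k"
  by (auto simp: translate_def)

lemma translate_Un: "translate (A \<union> B) k = translate A k \<union> translate B k"
  by (auto simp: translate_def)

text \<open>Equality can fail: the inner translation may push points below 1 that the outer one
  would have brought back.\<close>

lemma translate_translate_subset: "translate (translate A s) t \<subseteq> translate A (s + t)"
  unfolding translate_def by force

lemma translate_UN: "translate (\<Union>x\<in>F. g x) k = (\<Union>x\<in>F. translate (g x) k)"
  by (auto simp: translate_def)

text \<open>Real indices let a member be named by its intended density: \<open>A q\<close> will get
  the value \<open>q\<close> for \<open>0 < q < 1\<close>.\<close>

locale TAD_indexed =
  fixes I :: "nat set set" and A :: "real \<Rightarrow> nat set"
  assumes ideal: "ideal_on_PN I"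
    and finite_mem: "finite X \<Longrightarrow> X \<subseteq> PN \<Longrightarrow> X \<in> I"
    and translate_mem: "X \<in> I \<Longrightarrow> translate X k \<in> I"
    and A_subset: "A q \<subseteq> PN"
    and A_notin: "A q \<notin> I"
    and A_TAD: "p \<noteq> q \<Longrightarrow> TAD I (A p) (A q)"
begin

lemma mem_subset: "X \<in> I \<Longrightarrow> Y \<subseteq> X \<Longrightarrow> Y \<in> I"
  using ideal unfolding ideal_on_PN_def by blast

lemma mem_Un: "X \<in> I \<Longrightarrow> Y \<in> I \<Longrightarrow> X \<union> Y \<in> I"
  using ideal unfolding ideal_on_PN_def by blast

lemma mem_UN: "finite F \<Longrightarrow> (\<And>x. x \<in> F \<Longrightarrow> g x \<in> I) \<Longrightarrow> (\<Union>x\<in>F. g x) \<in> I"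
  by (induction F rule: finite_induct) (auto intro: mem_Un finite_mem)

section \<open>The increasing chain of ideals\<close>

definition cover :: "(real \<times> int) set \<Rightarrow> nat set" where
  "cover F = (\<Union>p\<in>F. translate (A (fst p)) (snd p))"

text \<open>The interval is open at 0, hence empty for \<open>r = 0\<close>, so that the chain
  starts at \<open>I\<close> itself.\<close>

definition level :: "real \<Rightarrow> nat set set" where
  "level r = {X. X \<subseteq> PN \<and> (\<exists>F. finite F \<and> F \<subseteq> {0<..r} \<times> UNIV \<and> X - cover F \<in> I)}"

lemma level_0: "level 0 = I"
  using ideal by (auto simp: level_def cover_def ideal_on_PN_def)

lemma level_mono: "r \<le> r' \<Longrightarrow> level r \<subseteq> level r'"
proof
  fix X assume "r \<le> r'" "X \<in> level r"
  moreover from this have "{0<..r} \<times> UNIV \<subseteq> {0<..r'} \<times> (UNIV :: int set)" by auto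
  ultimately show "X \<in> level r'" unfolding level_def by (blast dest: subset_trans)
qed

lemma level_subset: "X \<in> level r \<Longrightarrow> Y \<subseteq> X \<Longrightarrow> Y \<in> level r"
proof -
  assume "X \<in> level r" and YX: "Y \<subseteq> X"
  then obtain F where F: "X \<subseteq> PN" "finite F" "F \<subseteq> {0<..r} \<times> UNIV" "X - cover F \<in> I"
    unfolding level_def by blast
  have "Y - cover F \<in> I" using F(4) by (rule mem_subset) (use YX in blast)
  then show "Y \<in> level r" unfolding level_def using F YX by (auto intro!: exI [of _ F])
qed

lemma level_Un:
  assumes "X \<in> level r" "Y \<in> level r"
  shows "X \<union> Y \<in> level r"
proof -
  obtain F G where F: "X \<subseteq> PN" "finite F" "F \<subseteq> {0<..r} \<times> UNIV" "X - cover F \<in> I"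
    and G: "Y \<subseteq> PN" "finite G" "G \<subseteq> {0<..r} \<times> UNIV" "Y - cover G \<in> I"
    using assms unfolding level_def by blast
  have "X \<union> Y - cover (F \<union> G) \<subseteq> (X - cover F) \<union> (Y - cover G)"
    by (auto simp: cover_def)
  then have "X \<union> Y - cover (F \<union> G) \<in> I" using F G mem_Un mem_subset by blast
  then show ?thesis using F G unfolding level_def
    by (auto intro!: exI [of _ "F \<union> G"])
qed

text \<open>Adding \<open>k\<close> to all shifts of a finite cover of \<open>X\<close> covers the
  translate, up to a translate of the exceptional set, which stays in \<open>I\<close>.\<close>

lemma level_translate:
  assumes "X \<in> level r"
  shows "translate X k \<in> level r"
proof -
  obtain F where F: "finite F" "F \<subseteq> {0<..r} \<times> UNIV" "X - cover F \<in> I"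
    using assms unfolding level_def by blast
  define G where "G = (\<lambda>p. (fst p, snd p + k)) ` F"
  have "translate (cover F) k \<subseteq> cover G"
    using translate_translate_subset by (fastforce simp: cover_def G_def translate_UN)
  moreover have "translate X k \<subseteq> translate (X - cover F) k \<union> translate (cover F) k"
    unfolding translate_Un [symmetric] by (rule translate_mono) blast
  ultimately have "translate X k - cover G \<subseteq> translate (X - cover F) k" by blast
  then have "translate X k - cover G \<in> I" using F translate_mem mem_subset by blast
  moreover have "finite G" "G \<subseteq> {0<..r} \<times> UNIV" using F by (auto simp: G_def)
  ultimately show ?thesis using translate_subset_PN unfolding level_def by blast
qed

text \<open>Modulo \<open>I\<close>, the set \<open>X\<close> is a finite union of its intersections
  with translates of the generators; if all these are in \<open>I\<close>, so is
  \<open>X\<close>.\<close>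

lemma mem_if_level:
  assumes "X \<in> level r" and small: "\<And>q s. 0 < q \<Longrightarrow> q \<le> r \<Longrightarrow> X \<inter> translate (A q) s \<in> I"
  shows "X \<in> I"
proof -
  obtain F where F: "finite F" "F \<subseteq> {0<..r} \<times> UNIV" "X - cover F \<in> I"
    using assms unfolding level_def by blast
  have "(\<Union>p\<in>F. X \<inter> translate (A (fst p)) (snd p)) \<in> I"
    using F by (intro mem_UN small) auto
  with F(3) have "(X - cover F) \<union> (\<Union>p\<in>F. X \<inter> translate (A (fst p)) (snd p)) \<in> I"
    by (rule mem_Un)
  then show ?thesis by (rule mem_subset) (auto simp: cover_def)
qed

lemma A_in_level_iff:
  assumes "0 < q"
  shows "A q \<in> level r \<longleftrightarrow> q \<le> r"
proof
  have tr: "translate (A q) 0 = A q" using A_subset [of q] by (auto simp: translate_def)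
  show "q \<le> r" if "A q \<in> level r"
  proof (rule ccontr)
    assume "\<not> q \<le> r"
    \<comment> \<open>All generators of \<open>level r\<close> have indices below \<open>q\<close>,
      so almost disjointness makes \<open>A q\<close> small on each of them.\<close>
    then have "A q \<inter> translate (A q') s \<in> I" if "q' \<le> r" for q' s
      using A_TAD [of q q'] that tr unfolding TAD_def by (metis linorder_not_le)
    then show False using mem_if_level that A_notin by blast
  qed
  show "A q \<in> level r" if "q \<le> r"
    unfolding level_def using that assms A_subset finite_mem [of "{}"]
    by (auto intro!: exI [of _ "{(q, 0)}"] simp: cover_def tr)
qed

text \<open>Fix a finite cover of \<open>X\<close> and take \<open>e\<close> below all its indices.
  Every generator of \<open>level e\<close> meets the cover, and hence \<open>X\<close>, in a set of
  \<open>I\<close>. As \<open>X\<close> also lies in \<open>level e\<close>, it lies in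
  \<open>I\<close>.\<close>

lemma mem_if_all_levels:
  assumes "X \<in> level r" and all: "\<And>e. 0 < e \<Longrightarrow> X \<in> level e"
  shows "X \<in> I"
proof -
  obtain F where F: "finite F" "F \<subseteq> {0<..r} \<times> UNIV" "X - cover F \<in> I"
    using assms unfolding level_def by blast
  \<comment> \<open>Half of the least index in the cover; the inserted 1 handles an empty
    cover.\<close>
  define e where "e = Min (insert 1 (fst ` F)) / 2"
  have "0 < Min (insert 1 (fst ` F))" using F by (subst Min_gr_iff) auto
  then have e: "0 < e" and lt: "e < Min (insert 1 (fst ` F))" by (auto simp: e_def)
  have less: "e < fst p" if "p \<in> F" for p
    using lt F(1) that by (subst (asm) Min_gr_iff) auto
  show ?thesis
  proof (rule mem_if_level [OF all [OF e]])
    fix q s assume "q \<le> e"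
    have "translate (A (fst p)) (snd p) \<inter> translate (A q) s \<in> I" if "p \<in> F" for p
      using A_TAD [of "fst p" q] less [OF that] \<open>q \<le> e\<close> unfolding TAD_def by force
    then have "(\<Union>p\<in>F. translate (A (fst p)) (snd p) \<inter> translate (A q) s) \<in> I"
      using F by (intro mem_UN)
    with F(3) have "(X - cover F) \<union> (\<Union>p\<in>F. translate (A (fst p)) (snd p) \<inter> translate (A q) s) \<in> I"
      by (rule mem_Un)
    then show "X \<inter> translate (A q) s \<in> I" by (rule mem_subset) (auto simp: cover_def)
  qed
qed

section \<open>The density as an infimum over the chain\<close>

definition density :: "nat set \<Rightarrow> real" where
  "density X = Inf (insert 1 {r \<in> {0..<1}. X \<in> level r})"

lemma bdd_below_levels: "bdd_below (insert 1 {r \<in> {0..<1}. X \<in> level r})"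
  by (rule bdd_belowI [of _ 0]) auto

lemma density_nonneg: "0 \<le> density X"
  unfolding density_def by (rule cInf_greatest) auto

lemma density_le_1: "density X \<le> 1"
  unfolding density_def by (rule cInf_lower [OF _ bdd_below_levels]) simp

lemma density_le: "0 \<le> r \<Longrightarrow> r < 1 \<Longrightarrow> X \<in> level r \<Longrightarrow> density X \<le> r"
  unfolding density_def by (rule cInf_lower [OF _ bdd_below_levels]) simp

text \<open>The inserted 1 is the default value for sets in no level below 1. As
  \<open>r \<le> 1\<close>, a witness below \<open>r\<close> is a genuine level, and levels
  increase.\<close>

lemma density_lessD:
  assumes "density X < r" "r \<le> 1"
  shows "X \<in> level r"
proof -
  obtain r' where "r' \<in> insert 1 {r \<in> {0..<1}. X \<in> level r}" "r' < r"
    using cInf_lessD [OF insert_not_empty assms(1) [unfolded density_def]] by blast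
  then show ?thesis using assms(2) level_mono [of r' r] by auto
qed

text \<open>Turns closure properties of levels into inequalities of densities. Only \<open>r\<close>
  strictly above \<open>density X\<close> is considered, since the infimum need not be
  attained.\<close>

lemma density_leI:
  assumes "\<And>r. density X < r \<Longrightarrow> r < 1 \<Longrightarrow> Y \<in> level r"
  shows "density Y \<le> density X"
proof (rule ccontr)
  assume "\<not> density Y \<le> density X"
  then obtain r where r: "density X < r" "r < density Y" using dense not_le by blast
  then have "r < 1" using density_le_1 [of Y] by linarith
  then have "density Y \<le> r" using density_le assms r density_nonneg [of X] by simp
  then show False using r by simp
qed

lemma density_mono: "X \<subseteq> Y \<Longrightarrow> density X \<le> density Y"
  by (rule density_leI, rule level_subset [OF density_lessD]) auto

text \<open>The maximum suffices because any level above both densities contains both sets and is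
  closed under unions.\<close>

lemma density_Un: "density (X \<union> Y) \<le> max (density X) (density Y)"
proof (cases "density X \<le> density Y")
  case True
  then have "density (X \<union> Y) \<le> density Y"
    by (intro density_leI level_Un density_lessD) auto
  then show ?thesis by simp
next
  case False
  then have "density (X \<union> Y) \<le> density X"
    by (intro density_leI level_Un density_lessD) auto
  then show ?thesis by simp
qed

lemma density_translate_le: "density (translate X k) \<le> density X"
  by (intro density_leI level_translate density_lessD) auto

lemma density_eq_0_iff: "density X = 0 \<longleftrightarrow> X \<in> I"
proof
  show "X \<in> I" if "density X = 0"
  proof (rule mem_if_all_levels)
    show "X \<in> level 1" using that by (intro density_lessD) auto
    show "X \<in> level e" if "0 < e" for e
    proof -
      \<comment> \<open>Capping at 1 is required by \<open>density_lessD\<close>.\<close>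
      have "X \<in> level (min e 1)"
        using that \<open>density X = 0\<close> by (intro density_lessD) auto
      then show ?thesis using level_mono [of "min e 1" e] by auto
    qed
  qed
  show "density X = 0" if "X \<in> I"
    using density_le [of 0 X] that density_nonneg [of X] by (simp add: level_0)
qed

text \<open>Translating back recovers \<open>X\<close> except for points up to
  \<open>\<bar>k\<bar>\<close> that were pushed below 1; these form a finite set, of density
  0.\<close>

lemma density_translate:
  assumes "X \<subseteq> PN"
  shows "density (translate X k) = density X"
proof (rule antisym [OF density_translate_le])
  have "X \<subseteq> translate (translate X k) (- k) \<union> {1..nat \<bar>k\<bar>}"
  proof
    fix n assume n: "n \<in> X"
    show "n \<in> translate (translate X k) (- k) \<union> {1..nat \<bar>k\<bar>}"
    proof (cases "0 < int n + k")
      case True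
      then have "nat (int n + k) \<in> translate X k"
        unfolding translate_def using n by force
      moreover have "int n = int (nat (int n + k)) + - k" using True by simp
      ultimately show ?thesis unfolding translate_def using n assms by blast
    next
      case False
      then show ?thesis using n assms by auto
    qed
  qed
  then have "density X \<le> density (translate (translate X k) (- k) \<union> {1..nat \<bar>k\<bar>})"
    by (rule density_mono)
  also have "\<dots> \<le> max (density (translate (translate X k) (- k))) (density {1..nat \<bar>k\<bar>})"
    by (rule density_Un)
  also have "density {1..nat \<bar>k\<bar>} = 0"
    by (subst density_eq_0_iff, rule finite_mem) auto
  also have "max (density (translate (translate X k) (- k))) 0 \<le> density (translate X k)"
    using density_translate_le density_nonneg by simp
  finally show "density X \<le> density (translate X k)" .
qed

lemma density_A:
  assumes "0 < q" "q < 1"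
  shows "density (A q) = q"
proof (rule antisym)
  show "density (A q) \<le> q" using assms by (intro density_le) (auto simp: A_in_level_iff)
  show "q \<le> density (A q)"
    unfolding density_def using assms by (intro cInf_greatest) (auto simp: A_in_level_iff)
qed

text \<open>\<open>PN\<close> contains every \<open>A q\<close>, and these have densities
  arbitrarily close to 1.\<close>

lemma density_PN: "density PN = 1"
proof (rule antisym [OF density_le_1], rule ccontr)
  assume "\<not> 1 \<le> density PN"
  then obtain q where q: "density PN < q" "q < 1" using dense not_le by blast
  have "0 < q" using q density_nonneg [of PN] by simp
  then have "q = density (A q)" using q density_A by simp
  also have "\<dots> \<le> density PN" by (rule density_mono [OF A_subset])
  finally show False using q by simp
qed

lemma abstract_upper_density_density: "abstract_upper_density density"
  unfolding abstract_upper_density_def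
proof (intro conjI allI impI)
  show "density X \<in> {0..1}" for X using density_nonneg density_le_1 by simp
  show "density PN = 1" by (rule density_PN)
  show "density F = 0" if "F \<subseteq> PN" "finite F" for F
    using that finite_mem by (simp add: density_eq_0_iff)
  show "density X \<le> density Y" if "X \<subseteq> Y" for X Y using that by (rule density_mono)
  show "density (X \<union> Y) \<le> density X + density Y" for X Y
    using density_Un [of X Y] density_nonneg [of X] density_nonneg [of Y] by linarith
qed

lemma translation_invariant_density: "translation_invariant density"
  unfolding translation_invariant_def translate_uminus [symmetric]
  by (simp add: density_translate)

lemma rich_density: "rich density"
  unfolding rich_def
proof
  fix r :: real assume r: "r \<in> {0..1}"
  consider "r = 0" | "r = 1" | "0 < r" "r < 1" 
    using r unfolding atLeastAtMost_iff by linarith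
  then show "\<exists>X. X \<subseteq> PN \<and> density X = r"
  proof cases
    case 1
    then show ?thesis using finite_mem [of "{}"] by (auto intro!: exI [of _ "{}"] simp: density_eq_0_iff)
  next
    case 2
    then show ?thesis using density_PN by blast
  next
    case 3
    then show ?thesis using density_A A_subset by blast
  qed
qed

lemma zero_ideal_density: "zero_ideal density = I"
  using ideal by (auto simp: zero_ideal_def density_eq_0_iff ideal_on_PN_def)

end

section \<open>The family and the density for a divergent monotone weight\<close>

theorem theorem2p2:
  fixes f :: "nat \<Rightarrow> real"
  assumes "\<forall>n\<in>PN. 0 \<le> f n"
    and "antimono_on PN f"
    and "\<not> f summable_on PN"
  shows "(\<exists>\<A>. TAD_family (summable_ideal f) \<A> \<and> \<A> \<approx> (UNIV :: real set)) \<and>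
         (\<exists>\<delta>. abstract_upper_density \<delta> \<and> translation_invariant \<delta> \<and> rich \<delta> \<and>
              zero_ideal \<delta> = summable_ideal f)"
proof -
  have nonneg: "\<And>n. n \<in> PN \<Longrightarrow> 0 \<le> f n" using assms(1) by blast
  have mono: "\<And>m n. 1 \<le> m \<Longrightarrow> m \<le> n \<Longrightarrow> f n \<le> f m"
    using assms(2) by (auto simp: monotone_on_def)
  obtain \<A> where \<A>: "TAD_family (summable_ideal f) \<A>" "\<A> \<approx> (UNIV :: real set)"
    using ex_TAD_family_summable_ideal [OF nonneg mono assms(3)] by blast
  \<comment> \<open>Indexing by a bijection makes members with different indices distinct, as the
    locale requires for almost disjointness.\<close>
  obtain A :: "real \<Rightarrow> nat set" where A: "bij_betw A UNIV \<A>"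
    using eqpoll_sym [OF \<A>(2)] unfolding eqpoll_def by blast
  interpret TAD_indexed "summable_ideal f" A
  proof
    show "ideal_on_PN (summable_ideal f)" using assms(3) by (rule ideal_summable_ideal)
    show "X \<in> summable_ideal f" if "finite X" "X \<subseteq> PN" for X
      using that by (rule finite_in_summable_ideal)
    show "translate X k \<in> summable_ideal f" if "X \<in> summable_ideal f" for X k
      using translate_in_summable_ideal [OF nonneg mono that] .
    have mem: "A q \<in> \<A>" for q using A by (auto simp: bij_betw_def)
    show "A q \<subseteq> PN" "A q \<notin> summable_ideal f" for q
      using \<A>(1) mem [of q] by (auto simp: TAD_family_def)
    show "TAD (summable_ideal f) (A p) (A q)" if "p \<noteq> q" for p q
      using \<A>(1) mem that A by (auto simp: TAD_family_def bij_betw_def inj_eq)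
  qed
  show ?thesis
    using \<A> abstract_upper_density_density translation_invariant_density rich_density
      zero_ideal_density by blast
qed

end
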